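(* Let $r\ge 0$ be an integer and let $S$ be the $(p,m,2)$ signed graph consisting of a positive edge, to which are attached $2$ negative pendant edges at one end and $r$ positive pendant edges at the other end. If $r>2$ then $S$ is not additively graceful.
   Context: A signed graph $S$ is a finite simple graph on $p$ vertices in which $m$ edges are specified as positive and the remaining $n$ edges are specified as negative; it is then called a $(p,m,n)$ signed graph, with sets of positive and negative edges $E^+(S)$ and $E^-(S)$. Attaching a pendant edge at a vertex $z$ means adding a new vertex of degree 1 joined to $z$. Thus $S$ has positive edges $z_1z_2$, $z_2w_i$ ($1\le i\le r$) and negative edges $z_1u_1$, $z_1u_2$, all these vertices being distinct, and no other vertices or edges. An additively graceful labeling of a $(p,m,n)$ signed graph $S=(V,E)$ is an injective map $f:V\to\{0,1,\dots,m+\lceil\frac{n+1}{2}\rceil\}$ such that, with $f^*(uv)=f(u)+f(v)$ for $uv\in E^-(S)$ and $f^*(uv)=|f(u)-f(v)|$ for $uv\in E^+(S)$, one has $\{f^*(uv):uv\in E^-(S)\}=\{1,2,\dots,n\}$ and $\{f^*(uv):uv\in E^+(S)\}=\{1,2,\dots,m\}$. $S$ is additively graceful if it admits such a labeling. *)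

theory Defs
  imports Complex_Main
begin

record 'a signed_graph =
  verts :: "'a set"
  pos_edges :: "'a set set"
  neg_edges :: "'a set set"

definition pmn_signed_graph :: "nat \<Rightarrow> nat \<Rightarrow> nat \<Rightarrow> 'a signed_graph \<Rightarrow> bool" where
  "pmn_signed_graph p m n S \<longleftrightarrow>
     finite (verts S) \<and> card (verts S) = p \<and>
     (\<forall>e \<in> pos_edges S \<union> neg_edges S. e \<subseteq> verts S \<and> card e = 2) \<and>
     pos_edges S \<inter> neg_edges S = {} \<and>
     card (pos_edges S) = m \<and> card (neg_edges S) = n"

text \<open>Labels are integers, so that differences are not truncated. The values of \<open>f\<close> outside
  the vertex set are irrelevant. The numbers \<open>m\<close> and \<open>n\<close> are read off from the graph as the
  numbers of positive and negative edges.\<close>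

definition additively_graceful_labeling :: "'a signed_graph \<Rightarrow> ('a \<Rightarrow> int) \<Rightarrow> bool" where
  "additively_graceful_labeling S f \<longleftrightarrow>
     (let m = card (pos_edges S); n = card (neg_edges S) in
       inj_on f (verts S) \<and>
       f ` verts S \<subseteq> {0 .. int m + \<lceil>(real n + 1) / 2\<rceil>} \<and>
       {f u + f v | u v. {u, v} \<in> neg_edges S} = {1 .. int n} \<and>
       {\<bar>f u - f v\<bar> | u v. {u, v} \<in> pos_edges S} = {1 .. int m})"

definition additively_graceful :: "'a signed_graph \<Rightarrow> bool" where
  "additively_graceful S \<longleftrightarrow> (\<exists>f. additively_graceful_labeling S f)"

text \<open>The graph with a positive edge \<open>z1 z2\<close>, negative pendant edges to \<open>u1\<close> and \<open>u2\<close> at \<open>z1\<close>,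
  and positive pendant edges to \<open>w 1, \<dots>, w r\<close> at \<open>z2\<close>. It has the intended shape only if the named
  vertices are pairwise distinct, which is the predicate \<open>distinct_vertices\<close>.\<close>

definition pendant_graph ::
    "nat \<Rightarrow> 'a \<Rightarrow> 'a \<Rightarrow> 'a \<Rightarrow> 'a \<Rightarrow> (nat \<Rightarrow> 'a) \<Rightarrow> 'a signed_graph" where
  "pendant_graph r z1 z2 u1 u2 w =
     \<lparr> verts = {z1, z2, u1, u2} \<union> w ` {1..r},
       pos_edges = {{z1, z2}} \<union> {{z2, w i} | i. i \<in> {1..r}},
       neg_edges = {{z1, u1}, {z1, u2}} \<rparr>"

definition distinct_vertices ::
    "nat \<Rightarrow> 'a \<Rightarrow> 'a \<Rightarrow> 'a \<Rightarrow> 'a \<Rightarrow> (nat \<Rightarrow> 'a) \<Rightarrow> bool" where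
  "distinct_vertices r z1 z2 u1 u2 w \<longleftrightarrow>
     distinct [z1, z2, u1, u2] \<and> inj_on w {1..r} \<and> {z1, z2, u1, u2} \<inter> w ` {1..r} = {}"

lemma pmn_pendant_graph:
  assumes "distinct_vertices r z1 z2 u1 u2 w"
  shows "pmn_signed_graph (r + 4) (r + 1) 2 (pendant_graph r z1 z2 u1 u2 w)"
proof -
  have d: "distinct [z1, z2, u1, u2]" and inj: "inj_on w {1..r}"
    and w: "\<And>i. i \<in> {1..r} \<Longrightarrow> w i \<notin> {z1, z2, u1, u2}"
    using assms by (auto simp: distinct_vertices_def)
  have "card ({z1, z2, u1, u2} \<union> w ` {1..r}) = card {z1, z2, u1, u2} + card (w ` {1..r})"
    by (rule card_Un_disjoint) (use assms in \<open>auto simp: distinct_vertices_def\<close>)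
  then have p: "card ({z1, z2, u1, u2} \<union> w ` {1..r}) = r + 4"
    using d inj by (simp add: card_image)
  have im: "{{z2, w i} | i. i \<in> {1..r}} = (\<lambda>i. {z2, w i}) ` {1..r}" by auto
  have "inj_on (\<lambda>i. {z2, w i}) {1..r}"
  proof (rule inj_onI)
    fix i j assume ij: "i \<in> {1..r}" "j \<in> {1..r}" and "{z2, w i} = {z2, w j}"
    then have "w i = w j" by (metis doubleton_eq_iff)
    then show "i = j" using inj_onD[OF inj _ ij] by simp
  qed
  then have c: "card {{z2, w i} | i. i \<in> {1..r}} = r"
    unfolding im by (simp add: card_image)
  have "{z1, z2} \<notin> {{z2, w i} | i. i \<in> {1..r}}"
  proof
    assume "{z1, z2} \<in> {{z2, w i} | i. i \<in> {1..r}}"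
    then obtain i where i: "i \<in> {1..r}" "{z1, z2} = {z2, w i}" by blast
    then show False using w[OF i(1)] by (auto simp: doubleton_eq_iff)
  qed
  moreover have "finite {{z2, w i} | i. i \<in> {1..r}}" unfolding im by simp
  ultimately have m: "card ({{z1, z2}} \<union> {{z2, w i} | i. i \<in> {1..r}}) = r + 1"
    using c by simp
  have n: "card {{z1, u1}, {z1, u2}} = 2"
    using d by (auto simp: doubleton_eq_iff)
  have disj: "({{z1, z2}} \<union> {{z2, w i} | i. i \<in> {1..r}}) \<inter> {{z1, u1}, {z1, u2}} = {}"
  proof -
    have "z2 \<in> e" if "e \<in> {{z1, z2}} \<union> {{z2, w i} | i. i \<in> {1..r}}" for e
      using that by blast
    moreover have "z2 \<notin> {z1, u1}" "z2 \<notin> {z1, u2}" using d by auto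
    ultimately show ?thesis by blast
  qed
  have e: "e \<subseteq> {z1, z2, u1, u2} \<union> w ` {1..r} \<and> card e = 2"
    if "e \<in> ({{z1, z2}} \<union> {{z2, w i} | i. i \<in> {1..r}}) \<union> {{z1, u1}, {z1, u2}}" for e
  proof -
    from that consider "e = {z1, z2}" | "e = {z1, u1}" | "e = {z1, u2}"
      | i where "i \<in> {1..r}" "e = {z2, w i}" by blast
    then show ?thesis
    proof cases
      case 4
      have "z2 \<noteq> w i" using w[OF 4(1)] by blast
      then show ?thesis using 4 by simp
    qed (use d in simp_all)
  qed
  have fin: "finite ({z1, z2, u1, u2} \<union> w ` {1..r})" by simp
  show ?thesis
    unfolding pmn_signed_graph_def pendant_graph_def signed_graph.simps
    by (intro conjI ballI fin p m n disj e[THEN conjunct1] e[THEN conjunct2])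
qed

end

theory Submission
  imports Defs
begin

text \<open>Let \<open>m = r + 1\<close>, so labels lie in \<open>{0..m + 2}\<close>. Two negative edges at \<open>z1\<close> must have
  label sums 1 and 2. Since labels are distinct and non-negative, this forces the label 0 on
  \<open>z1\<close> and the labels 1 and 2 on its negative neighbours, so \<open>z2\<close> and all \<open>w i\<close> have labels in
  \<open>{3..m + 2}\<close>. Two such labels differ by less than \<open>m\<close>, hence the difference \<open>m\<close> can only occur
  on \<open>z1 z2\<close>, and \<open>z2\<close> has the label \<open>m\<close>. Now consider the difference \<open>m - 1\<close>. It has to occur
  on an edge \<open>z2 (w i)\<close>, so the label of \<open>w i\<close> is \<open>1\<close> or \<open>2 m - 1\<close>. The first is
  below 3, and the second exceeds \<open>m + 2\<close> as soon as \<open>m > 3\<close>, that is, \<open>r > 2\<close>.\<close>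

lemma two_negative_pendants_labels:
  fixes a b c :: int
  assumes "a \<ge> 0" "b \<ge> 0" "c \<ge> 0" "a \<noteq> b" "a \<noteq> c"
    and sums: "{a + b, a + c} = {1, 2}"
  shows "a = 0" "{b, c} = {1, 2}"
proof -
  from sums have "a + b = 1 \<and> a + c = 2 \<or> a + b = 2 \<and> a + c = 1"
    by (simp add: doubleton_eq_iff)
  \<comment> \<open>The sum 1 needs the labels 0 and 1 at its ends. With 1 at the common vertex the other
    leaf, whose sum is 2, would have the label 1 again.\<close>
  then show "a = 0" using assms(1-5) by linarith
  then show "{b, c} = {1, 2}" using sums by simp
qed

text \<open>The differences \<open>m\<close> and \<open>m - 1\<close> alone already exclude every choice of the label \<open>t\<close> for
  \<open>z2\<close>: the first determines \<open>t\<close>, and the second is then out of reach. The set \<open>W\<close> stands for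
  the labels of the positive pendant vertices.\<close>

lemma no_star_differences:
  fixes m t :: int
  assumes m: "m > 3"
    and t: "t \<in> {3..m + 2}"
    and W: "W \<subseteq> {3..m + 2}"
    and diffs: "{1..m} \<subseteq> insert t ((\<lambda>x. \<bar>t - x\<bar>) ` W)"
  shows False
proof -
  have t_eq: "t = m"
  proof (rule ccontr)
    assume "t \<noteq> m"
    moreover have "m \<in> {1..m}" using m by simp
    ultimately obtain x where "x \<in> W" "m = \<bar>t - x\<bar>" using diffs by blast
    then show False using W t by force
  qed
  have "m - 1 \<in> {1..m}" "m - 1 \<noteq> t" using m t_eq by simp_all
  then obtain x where x: "x \<in> W" "m - 1 = \<bar>m - x\<bar>" using diffs unfolding t_eq by blast
  then have "3 \<le> x" "x \<le> m + 2" using W by auto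
  then show False using x(2) m by linarith
qed

theorem theorem4p5:
  fixes r :: nat and z1 z2 u1 u2 :: 'a and w :: "nat \<Rightarrow> 'a" and S :: "'a signed_graph"
  assumes "distinct_vertices r z1 z2 u1 u2 w"
    and "S = pendant_graph r z1 z2 u1 u2 w"
    and "r > 2"
  shows "\<not> additively_graceful S"
proof
  assume "additively_graceful S"
  then obtain f where f: "additively_graceful_labeling S f"
    by (auto simp: additively_graceful_def)
  let ?V = "{z1, z2, u1, u2} \<union> w ` {1..r}"
  define m where "m = int r + 1"
  have V: "verts S = ?V"
    and P: "pos_edges S = {{z1, z2}} \<union> {{z2, w i} | i. i \<in> {1..r}}"
    and N: "neg_edges S = {{z1, u1}, {z1, u2}}"
    by (simp_all add: assms(2) pendant_graph_def)
  have card: "card (pos_edges S) = r + 1" "card (neg_edges S) = 2"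
    using pmn_pendant_graph[OF assms(1)] by (simp_all add: assms(2) pmn_signed_graph_def)
  have "\<lceil>(real 2 + 1) / 2\<rceil> = 2" by (simp add: ceiling_eq_iff)
  then have inj: "inj_on f ?V" and range: "f ` ?V \<subseteq> {0..m + 2}"
    and neg: "{f u + f v | u v. {u, v} \<in> neg_edges S} = {1..2}"
    and pos: "{\<bar>f u - f v\<bar> | u v. {u, v} \<in> pos_edges S} = {1..m}"
    using f by (simp_all add: additively_graceful_labeling_def card V m_def Let_def add.commute)
  have d: "distinct [z1, z2, u1, u2]" and w: "{z1, z2, u1, u2} \<inter> w ` {1..r} = {}"
    using assms(1) by (simp_all add: distinct_vertices_def)

  \<comment> \<open>An edge is an unordered pair, so each edge is read in both directions here; sums and
    absolute differences do not depend on the direction.\<close>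
  have "{f u + f v | u v. {u, v} \<in> neg_edges S} = {f z1 + f u1, f z1 + f u2}"
    unfolding N by (auto simp: doubleton_eq_iff add.commute)
  moreover have "{1..2} = {1, 2 :: int}" by auto
  ultimately have sums: "{f z1 + f u1, f z1 + f u2} = {1, 2}" using neg by simp
  have ne: "f z1 \<noteq> f u1" "f z1 \<noteq> f u2"
    using inj_onD[OF inj, of z1 u1] inj_onD[OF inj, of z1 u2] d by auto
  have ge: "f z1 \<ge> 0" "f u1 \<ge> 0" "f u2 \<ge> 0" using range by auto
  note z1 = two_negative_pendants_labels(1)[OF ge ne sums]
    and u = two_negative_pendants_labels(2)[OF ge ne sums]

  have high: "f x \<in> {3..m + 2}" if x: "x \<in> insert z2 (w ` {1..r})" for x
  proof -
    have "x \<notin> {z1, u1, u2}" using x d w by auto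
    moreover have "x \<in> ?V" using x by blast
    ultimately have "f x \<notin> f ` {z1, u1, u2}"
      using inj_on_image_mem_iff[OF inj, of x "{z1, u1, u2}"] by blast
    then have "f x \<notin> {0, 1, 2}" using z1 u by (metis image_empty image_insert)
    moreover have "f x \<in> {0..m + 2}" using range \<open>x \<in> ?V\<close> by blast
    ultimately show ?thesis by auto
  qed
  have "{\<bar>f u - f v\<bar> | u v. {u, v} \<in> pos_edges S}
      \<subseteq> insert (f z2) ((\<lambda>x. \<bar>f z2 - x\<bar>) ` f ` w ` {1..r})"
  proof clarify
    fix a b assume ab: "{a, b} \<in> pos_edges S" and nw: "\<bar>f a - f b\<bar> \<notin> (\<lambda>x. \<bar>f z2 - x\<bar>) ` f ` w ` {1..r}"
    from ab consider "{a, b} = {z1, z2}" | i where "i \<in> {1..r}" "{a, b} = {z2, w i}"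
      unfolding P by blast
    then show "\<bar>f a - f b\<bar> = f z2"
    proof cases
      case 1
      then show ?thesis using z1 high[of z2] by (auto simp: doubleton_eq_iff)
    next
      case 2
      then have "\<bar>f a - f b\<bar> = \<bar>f z2 - f (w i)\<bar>" by (auto simp: doubleton_eq_iff)
      then show ?thesis using nw 2(1) by blast
    qed
  qed
  then have "{1..m} \<subseteq> insert (f z2) ((\<lambda>x. \<bar>f z2 - x\<bar>) ` f ` w ` {1..r})" by (simp add: pos)
  moreover have "m > 3" using assms(3) by (simp add: m_def)
  moreover have "f z2 \<in> {3..m + 2}" "f ` w ` {1..r} \<subseteq> {3..m + 2}" using high by blast+
  ultimately show False using no_star_differences by blast
qed

end
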